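(* Let $d\ge3$ be an integer. There is a positive integer $c$ depending only on $d$ such that the following holds for all positive integers $n,t$. In the blown-up cube $\mathcal{BEC}^d(cn,t)$ let $$P=\big([n]^{d-1}\times\{1\}\big)\times[t],\qquad Q=\big([n]^{d-1}\times\{cn\}\big)\times[t].$$ Then any matching $M$ between $P$ and $Q$ can be embedded in $\mathcal{BEC}^d(cn,t)$; that is, there is a set of pairwise vertex-disjoint paths in $\mathcal{BEC}^d(cn,t)$ consisting of one path connecting $p$ and $q$ for each $pq\in M$.
   Context: For an integer $m$, $[m]=\{1,\dots,m\}$. $\mathcal{EC}^d(m)$ is the $d$-dimensional grid graph with vertex set $[m]^d$ in which two vertices are adjacent iff their Euclidean distance is $1$. $\mathcal{BEC}^d(m,t)$ is its $t$-fold blowup: the vertex set is $[m]^d\times[t]$, and distinct vertices $(x,i)$ and $(y,j)$ are adjacent iff $x=y$ or $xy\in E(\mathcal{EC}^d(m))$. A matching between $P$ and $Q$ is a set of pairwise disjoint pairs $pq$ with $p\in P$, $q\in Q$ (these pairs need not be edges of the graph). *)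

theory Defs
  imports
    "HOL-Analysis.L2_Norm"
    "HOL-Library.FuncSet"
    "HOL-Library.Disjoint_Sets"
    "Graph_Theory.Pair_Digraph"
    "Graph_Theory.Vertex_Walk"
begin

text \<open>
  Finite simple graphs are the \<^locale>\<open>pair_graph\<close> instances of the digraph library, i.e.
  finite, loop-free and symmetric: the undirected edge xy is represented by the two arcs
  (x, y) and (y, x). A path is a list of distinct vertices, see \<^const>\<open>vpath\<close>.

  Points of the d-dimensional grid are extensional functions on the coordinate set
  \<open>{1..d}\<close>, so that equality of points is equality of all d coordinates.
\<close>

type_synonym point = "nat \<Rightarrow> nat"

definition grid_points :: "nat \<Rightarrow> nat \<Rightarrow> point set" where
  "grid_points d m = {1..d} \<rightarrow>\<^sub>E {1..m}"

definition euclidean_dist :: "nat \<Rightarrow> point \<Rightarrow> point \<Rightarrow> real" where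
  "euclidean_dist d x y = L2_set (\<lambda>i. real (x i) - real (y i)) {1..d}"

definition EC :: "nat \<Rightarrow> nat \<Rightarrow> point pair_pre_digraph" where
  "EC d m = \<lparr> pverts = grid_points d m,
     parcs = {(x, y). x \<in> grid_points d m \<and> y \<in> grid_points d m \<and> euclidean_dist d x y = 1} \<rparr>"

definition blowup :: "'a pair_pre_digraph \<Rightarrow> nat \<Rightarrow> ('a \<times> nat) pair_pre_digraph" where
  "blowup G t = \<lparr> pverts = pverts G \<times> {1..t},
     parcs = {(u, v). u \<in> pverts G \<times> {1..t} \<and> v \<in> pverts G \<times> {1..t} \<and> u \<noteq> v \<and>
                (fst u = fst v \<or> (fst u, fst v) \<in> parcs G)} \<rparr>"

definition BEC :: "nat \<Rightarrow> nat \<Rightarrow> nat \<Rightarrow> (point \<times> nat) pair_pre_digraph" where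
  "BEC d m t = blowup (EC d m) t"

definition slice :: "nat \<Rightarrow> nat \<Rightarrow> nat \<Rightarrow> point set" where
  "slice d n a = (\<Pi>\<^sub>E i\<in>{1..d}. if i = d then {a} else {1..n})"

text \<open>
  The pair pq of a matching between \<open>P\<close> and \<open>Q\<close> is recorded as the ordered pair
  (p, q); disjointness of two pairs concerns their underlying sets of endpoints.
\<close>

definition matching_between :: "'a set \<Rightarrow> 'a set \<Rightarrow> ('a \<times> 'a) set \<Rightarrow> bool" where
  "matching_between P Q M \<longleftrightarrow>
     M \<subseteq> P \<times> Q \<and> disjoint_family_on (\<lambda>(p, q). {p, q}) M"

definition embeddable :: "'a pair_pre_digraph \<Rightarrow> ('a \<times> 'a) set \<Rightarrow> bool" where
  "embeddable G M \<longleftrightarrow>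
     (\<exists>path :: 'a \<times> 'a \<Rightarrow> 'a list.
        (\<forall>(p, q)\<in>M. vpath (path (p, q)) (with_proj G) \<and>
                    hd (path (p, q)) = p \<and> last (path (p, q)) = q) \<and>
        disjoint_family_on (\<lambda>e. set (path e)) M)"

lemma euclidean_dist_commute: "euclidean_dist d x y = euclidean_dist d y x"
  by (simp add: euclidean_dist_def L2_set_def power2_commute)

lemma pair_graph_EC: "pair_graph (EC d m)"
proof
  have fin: "finite (grid_points d m)"
    by (simp add: grid_points_def finite_PiE)
  then show "finite (pverts (EC d m))"
    by (simp add: EC_def)
  show "finite (parcs (EC d m))"
    by (rule finite_subset[OF _ finite_cartesian_product[OF fin fin]]) (auto simp: EC_def)
qed (auto simp: EC_def symmetric_def sym_def euclidean_dist_commute,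
     auto simp: euclidean_dist_def L2_set_def)

lemma pair_graph_blowup:
  assumes "pair_graph G"
  shows "pair_graph (blowup G t)"
proof -
  interpret pair_graph G by (fact assms)
  have fin: "finite (pverts G \<times> {1..t})"
    by (simp add: pair_finite_verts)
  have sym: "(u, v) \<in> parcs G \<Longrightarrow> (v, u) \<in> parcs G" for u v
    using pair_sym_arcs by (auto simp: symmetric_def sym_def)
  show ?thesis
  proof
    show "finite (pverts (blowup G t))"
      using fin by (simp add: blowup_def)
    show "finite (parcs (blowup G t))"
      by (rule finite_subset[OF _ finite_cartesian_product[OF fin fin]]) (auto simp: blowup_def)
  qed (auto simp: blowup_def symmetric_def sym_def intro: sym)
qed

lemma pair_graph_BEC: "pair_graph (BEC d m t)"
  unfolding BEC_def by (intro pair_graph_blowup pair_graph_EC)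

end

theory Submission
  imports Defs
begin

text \<open>
  The last coordinate plays the role of time: all paths climb from height \<open>1\<close> to height
  \<open>cn\<close> through consecutive slabs of height \<open>5n\<close>, and inside a slab only one of the other
  coordinates of each path changes. Greedily edge-colouring bipartite multigraphs of maximum degree
  \<open>n\<close> with \<open>2n\<close> colours, one coordinate after the other, gives each pair \<open>(p, q)\<close> of the matching
  an intermediate point with coordinates in \<open>{1..2n}\<close> such that both \<open>p\<close> and \<open>q\<close> can
  be moved there one coordinate at a time without two pairs ever sharing a vertex at the end of a
  slab. To let the paths cross inside a slab, the points are first spread out to odd
  coordinates, which is possible without crossings; moving a coordinate from an odd to an even value
  then leaves room for a detour through the unoccupied neighbouring layer in a third direction, and
  this is where \<open>d \<ge> 3\<close> is needed. The way from \<open>q\<close> to the intermediate point is traversed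
  backwards by reflecting the heights.
\<close>

section \<open>Connectivity within a prescribed set of vertices\<close>

text \<open>\<open>W\<close> is the territory reserved for one walk: disjoint territories give
  disjoint paths, so walks may be glued freely and become paths only at the very end. The first two
  conjuncts are stated separately because the reflexive closure relates every \<open>u\<close> to
  itself.\<close>

definition linked :: "'a pair_pre_digraph \<Rightarrow> 'a set \<Rightarrow> 'a \<Rightarrow> 'a \<Rightarrow> bool" where
  "linked G W u v \<longleftrightarrow> u \<in> W \<and> u \<in> pverts G \<and> (u, v) \<in> (parcs G \<inter> W \<times> W)\<^sup>*"

lemma linked_refl: "u \<in> W \<Longrightarrow> u \<in> pverts G \<Longrightarrow> linked G W u u"
  by (simp add: linked_def)

lemma linked_trans: "linked G W u v \<Longrightarrow> linked G W v w \<Longrightarrow> linked G W u w"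
  unfolding linked_def by (meson rtrancl_trans)

lemma linked_mono: "linked G W u v \<Longrightarrow> W \<subseteq> W' \<Longrightarrow> linked G W' u v"
  unfolding linked_def by (meson Int_mono Sigma_mono order_refl rtrancl_mono subsetD)

lemma linked_step:
  "u \<in> W \<Longrightarrow> v \<in> W \<Longrightarrow> u \<in> pverts G \<Longrightarrow> u = v \<or> (u, v) \<in> parcs G \<Longrightarrow> linked G W u v"
  unfolding linked_def by auto

lemma linked_mem: "linked G W u v \<Longrightarrow> u \<in> W \<and> v \<in> W"
  unfolding linked_def by (auto elim: rtranclE)

text \<open>Cutting the cycles out of a walk adds no vertices, so the resulting path stays in
  \<open>W\<close>.\<close>

lemma linked_vpath:
  assumes G: "pair_graph G" and "linked G W u v"
  shows "\<exists>p. vpath p (with_proj G) \<and> hd p = u \<and> last p = v \<and> set p \<subseteq> W"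
proof -
  interpret pair_graph G by (fact G)
  have "(u, v) \<in> (parcs G \<inter> W \<times> W)\<^sup>*" "u \<in> W" "u \<in> pverts G"
    using assms(2) by (auto simp: linked_def)
  then have "\<exists>p. vwalk p (with_proj G) \<and> hd p = u \<and> last p = v \<and> set p \<subseteq> W"
  proof (induction rule: converse_rtrancl_induct)
    case base
    then show ?case by (intro exI[of _ "[v]"]) (auto simp: vwalk_def)
  next
    case (step y z)
    then obtain p where p: "vwalk p (with_proj G)" "hd p = z" "last p = v" "set p \<subseteq> W"
      using in_arcsD2 by auto
    with step have "vwalk (y # p) (with_proj G)"
      by (intro vwalk_consI) auto
    moreover have "p \<noteq> []" using p(1) by auto
    ultimately show ?case using p step by (intro exI[of _ "y # p"]) auto
  qed
  then obtain p where p: "vwalk p (with_proj G)" "hd p = u" "last p = v" "set p \<subseteq> W" by blast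
  show ?thesis
    using p vwalk_to_vpath_vpath[OF p(1)] vwalk_to_vpath_subset[of _ p]
    by (intro exI[of _ "vwalk_to_vpath p"]) (auto simp: vwalk_to_vpath_hd vwalk_to_vpath_last)
qed

lemma linked_map:
  assumes "linked G W u v"
    and "\<And>a b. a \<in> W \<Longrightarrow> b \<in> W \<Longrightarrow> (a, b) \<in> parcs G \<Longrightarrow> (\<phi> a, \<phi> b) \<in> parcs G"
    and "\<phi> u \<in> pverts G"
  shows "linked G (\<phi> ` W) (\<phi> u) (\<phi> v)"
proof -
  have "(u, v) \<in> (parcs G \<inter> W \<times> W)\<^sup>*" using assms(1) by (simp add: linked_def)
  then have "(\<phi> u, \<phi> v) \<in> (parcs G \<inter> \<phi> ` W \<times> \<phi> ` W)\<^sup>*"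
  proof induction
    case (step y z)
    then have "(\<phi> y, \<phi> z) \<in> parcs G \<inter> \<phi> ` W \<times> \<phi> ` W" using assms(2) by auto
    with step show ?case by (meson rtrancl.rtrancl_into_rtrancl)
  qed simp
  then show ?thesis using assms by (auto simp: linked_def)
qed

lemma linked_target_pverts:
  assumes "pair_graph G" and "linked G W u v"
  shows "v \<in> pverts G"
proof -
  interpret pair_graph G by (fact assms)
  show ?thesis using assms(2) unfolding linked_def by (auto elim: rtranclE dest: in_arcsD2)
qed

lemma linked_sym:
  assumes G: "pair_graph G" and "linked G W u v"
  shows "linked G W v u"
proof -
  interpret pair_graph G by (fact G)
  have s: "(parcs G \<inter> W \<times> W)\<inverse> = parcs G \<inter> W \<times> W"
    using pair_sym_arcs by (auto simp: symmetric_def sym_def)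
  have "(v, u) \<in> ((parcs G \<inter> W \<times> W)\<inverse>)\<^sup>*"
    using assms(2) by (simp add: linked_def rtrancl_converse)
  then show ?thesis
    using linked_mem[OF assms(2)] linked_target_pverts[OF assms] unfolding s by (simp add: linked_def)
qed

section \<open>Single steps and straight segments in the blown-up grid\<close>

lemma grid_points_upd:
  "x \<in> grid_points d w \<Longrightarrow> l \<in> {1..d} \<Longrightarrow> a \<in> {1..w} \<Longrightarrow> x(l := a) \<in> grid_points d w"
  unfolding grid_points_def by (auto simp: PiE_iff extensional_def)

lemma pverts_BEC: "pverts (BEC d w t) = grid_points d w \<times> {1..t}"
  by (simp add: BEC_def blowup_def EC_def)

lemma euclidean_dist_unit:
  assumes "j \<in> {1..d}" "\<And>l. l \<noteq> j \<Longrightarrow> y l = x l" "y j = Suc (x j)"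
  shows "euclidean_dist d x y = 1"
proof -
  have "(\<Sum>i\<in>{1..d}. (real (x i) - real (y i))\<^sup>2) = (\<Sum>i\<in>{1..d}. if i = j then 1 else 0)"
    using assms by (intro sum.cong) auto
  then show ?thesis using assms(1) by (simp add: euclidean_dist_def L2_set_def)
qed

text \<open>The equality in the conclusion absorbs degenerate steps, as \<open>linked_step\<close>
  also accepts a step that stays in place. The copy may change freely, since the blow-up joins all
  copies of equal or adjacent points.\<close>

lemma BEC_near:
  assumes "x \<in> grid_points d w" "y \<in> grid_points d w" "j \<in> {1..d}"
    and eq: "\<And>l. l \<noteq> j \<Longrightarrow> y l = x l"
    and le: "x j \<le> Suc (y j)" "y j \<le> Suc (x j)" and "i \<in> {1..t}" "i' \<in> {1..t}"
  shows "(x, i) = (y, i') \<or> ((x, i), (y, i')) \<in> parcs (BEC d w t)"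
proof -
  consider "y j = x j" | "y j = Suc (x j)" | "x j = Suc (y j)" using le by linarith
  then have "x = y \<or> euclidean_dist d x y = 1"
  proof cases
    case 1
    then have "x l = y l" for l using eq by (cases "l = j") auto
    then show ?thesis by auto
  next
    case 2
    then show ?thesis using euclidean_dist_unit[OF assms(3), of y x] eq by blast
  next
    case 3
    then show ?thesis using euclidean_dist_unit[OF assms(3), of x y] eq
      by (metis euclidean_dist_commute)
  qed
  then show ?thesis using assms by (auto simp: BEC_def blowup_def EC_def)
qed

lemma linked_segment:
  assumes x: "x \<in> grid_points d w" and j: "j \<in> {1..d}" and i: "i \<in> {1..t}"
    and ab: "a \<in> {1..w}" "b \<in> {1..w}"
    and W: "\<And>y. min a b \<le> y \<Longrightarrow> y \<le> max a b \<Longrightarrow> (x(j := y), i) \<in> W"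
  shows "linked (BEC d w t) W (x(j := a), i) (x(j := b), i)"
proof -
  let ?G = "BEC d w t"
  define lo where "lo = min a b"
  have up: "lo + s \<le> max a b \<Longrightarrow> linked ?G W (x(j := lo), i) (x(j := lo + s), i)" for s
  proof (induction s)
    case 0
    have "x(j := lo) \<in> grid_points d w"
      using ab by (intro grid_points_upd[OF x j]) (auto simp: lo_def)
    then show ?case using i W[of lo] by (auto intro!: linked_refl simp: pverts_BEC lo_def simp del: fun_upd_apply)
  next
    case (Suc s)
    have g: "x(j := lo + s) \<in> grid_points d w" "x(j := lo + Suc s) \<in> grid_points d w"
      using Suc.prems ab by (auto intro!: grid_points_upd[OF x j] simp: lo_def)
    have "linked ?G W (x(j := lo + s), i) (x(j := lo + Suc s), i)"
      using Suc.prems i g by (intro linked_step W BEC_near[OF g j]) (auto simp: lo_def pverts_BEC)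
    moreover have "linked ?G W (x(j := lo), i) (x(j := lo + s), i)" using Suc by linarith
    ultimately show ?case using linked_trans by fast
  qed
  \<comment> \<open>One of \<open>a\<close> and \<open>b\<close> equals \<open>lo\<close>. Going
    from \<open>lo\<close> to both and reversing the first walk treats the two directions at
    once.\<close>
  have "linked ?G W (x(j := lo), i) (x(j := a), i)" using up[of "a - lo"] by (simp add: lo_def)
  moreover have "linked ?G W (x(j := lo), i) (x(j := b), i)"
    using up[of "b - lo"] by (simp add: lo_def)
  ultimately show ?thesis
    by (rule linked_trans[OF linked_sym[OF pair_graph_BEC]])
qed

section \<open>Families of disjoint climbs through a slab, stacked and reflected\<close>

definition at_height :: "nat \<Rightarrow> nat \<Rightarrow> point \<times> nat \<Rightarrow> point \<times> nat" where
  "at_height d h v = ((fst v)(d := h), snd v)"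

text \<open>
  The height of \<open>f e\<close> and \<open>g e\<close> is irrelevant: it is overwritten by \<open>lo\<close> and \<open>hi\<close>.
\<close>

definition route :: "nat \<Rightarrow> nat \<Rightarrow> nat \<Rightarrow> nat \<Rightarrow> nat \<Rightarrow> 'm set \<Rightarrow>
    ('m \<Rightarrow> point \<times> nat) \<Rightarrow> ('m \<Rightarrow> point \<times> nat) \<Rightarrow> bool" where
  "route d w t lo hi I f g \<longleftrightarrow> (\<exists>W. disjoint_family_on W I \<and>
     (\<forall>e\<in>I. (\<forall>v\<in>W e. lo \<le> fst v d \<and> fst v d \<le> hi) \<and>
            linked (BEC d w t) (W e) (at_height d lo (f e)) (at_height d hi (g e))))"

lemma routeI:
  assumes "\<And>e. e \<in> I \<Longrightarrow> linked (BEC d w t) (W e) (at_height d lo (f e)) (at_height d hi (g e))"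
    and "disjoint_family_on W I"
    and "\<And>e. e \<in> I \<Longrightarrow> \<forall>v\<in>W e. lo \<le> fst v d \<and> fst v d \<le> hi"
  shows "route d w t lo hi I f g"
  using assms unfolding route_def by (intro exI[of _ W]) simp

text \<open>Territories of the lower slab stay at heights up to \<open>mid\<close>, those of the
  upper slab above it, so only territories of the same slab could meet, and these are disjoint
  already. One vertical step at \<open>g e\<close> joins the two walks.\<close>

lemma route_trans:
  assumes "route d w t lo mid I f g" "route d w t (Suc mid) hi I g h" and "d > 0" and "lo \<le> mid"
    and "mid < hi"
  shows "route d w t lo hi I f h"
proof -
  let ?G = "BEC d w t"
  obtain U where U: "disjoint_family_on U I"
    "\<And>e v. e \<in> I \<Longrightarrow> v \<in> U e \<Longrightarrow> lo \<le> fst v d \<and> fst v d \<le> mid"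
    "\<And>e. e \<in> I \<Longrightarrow> linked ?G (U e) (at_height d lo (f e)) (at_height d mid (g e))"
    using assms(1) unfolding route_def by blast
  obtain V where V: "disjoint_family_on V I"
    "\<And>e v. e \<in> I \<Longrightarrow> v \<in> V e \<Longrightarrow> Suc mid \<le> fst v d \<and> fst v d \<le> hi"
    "\<And>e. e \<in> I \<Longrightarrow> linked ?G (V e) (at_height d (Suc mid) (g e)) (at_height d hi (h e))"
    using assms(2) unfolding route_def by blast
  have "linked ?G (U e \<union> V e) (at_height d lo (f e)) (at_height d hi (h e))" if e: "e \<in> I" for e
  proof -
    have v: "at_height d mid (g e) \<in> pverts ?G" "at_height d (Suc mid) (g e) \<in> pverts ?G"
      using linked_target_pverts[OF pair_graph_BEC U(3)[OF e]] V(3)[OF e] by (auto simp: linked_def)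
    have "linked ?G (U e \<union> V e) (at_height d mid (g e)) (at_height d (Suc mid) (g e))"
    proof (rule linked_step)
      show "at_height d mid (g e) = at_height d (Suc mid) (g e) \<or>
          (at_height d mid (g e), at_height d (Suc mid) (g e)) \<in> parcs ?G"
        using v \<open>d > 0\<close> unfolding at_height_def by (intro BEC_near[of _ _ _ _ d]) (auto simp: pverts_BEC)
    qed (use linked_mem[OF U(3)[OF e]] linked_mem[OF V(3)[OF e]] v in auto)
    moreover have "linked ?G (U e \<union> V e) (at_height d lo (f e)) (at_height d mid (g e))"
      by (rule linked_mono[OF U(3)[OF e]]) simp
    moreover have "linked ?G (U e \<union> V e) (at_height d (Suc mid) (g e)) (at_height d hi (h e))"
      by (rule linked_mono[OF V(3)[OF e]]) simp
    ultimately show ?thesis by (meson linked_trans)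
  qed
  moreover have "disjoint_family_on (\<lambda>e. U e \<union> V e) I"
    unfolding disjoint_family_on_def
  proof (intro ballI impI)
    fix a b assume ab: "a \<in> I" "b \<in> I" "a \<noteq> b"
    have "U a \<inter> U b = {}" "V a \<inter> V b = {}"
      using U(1) V(1) ab by (auto simp: disjoint_family_on_def)
    moreover have "U a \<inter> V b = {}" "V a \<inter> U b = {}"
      using U(2) V(2) ab by fastforce+
    ultimately show "(U a \<union> V a) \<inter> (U b \<union> V b) = {}" by auto
  qed
  moreover have "\<forall>v\<in>U e \<union> V e. lo \<le> fst v d \<and> fst v d \<le> hi" if "e \<in> I" for e
    using U(2)[OF that] V(2)[OF that] assms(4,5) by fastforce
  ultimately show ?thesis by (intro routeI)
qed

lemma route_chain:
  assumes "\<And>s. s < K \<Longrightarrow> route d w t (lo + s * L) (lo + s * L + L - 1) I (F s) (F (Suc s))"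
    and "K > 0" "L > 0" "d > 0"
  shows "route d w t lo (lo + K * L - 1) I (F 0) (F K)"
  using assms(2,1)
proof (induction K rule: nat_induct_non_zero)
  case 1
  then show ?case using \<open>L > 0\<close> by auto
next
  case (Suc K)
  have "route d w t lo (lo + K * L - 1) I (F 0) (F K)" using Suc by auto
  moreover have "route d w t (Suc (lo + K * L - 1)) (lo + Suc K * L - 1) I (F K) (F (Suc K))"
    using Suc.prems[of K] Suc.hyps \<open>L > 0\<close> by (simp add: algebra_simps)
  moreover have KL: "K * L > 0" using Suc.hyps \<open>L > 0\<close> by simp
  have "lo + K * L - 1 < lo + Suc K * L - 1" using KL \<open>L > 0\<close> unfolding mult_Suc by linarith
  moreover have "lo \<le> lo + K * L - 1" using KL by linarith
  ultimately show ?case using \<open>d > 0\<close> route_trans by blast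
qed

text \<open>Replacing height \<open>h\<close> by \<open>lo + hi - h\<close> is an automorphism of
  the slab that exchanges its bottom and top. It turns a climb from \<open>f e\<close> to
  \<open>g e\<close> into a descent, and reading that backwards gives a climb from
  \<open>g e\<close> to \<open>f e\<close>.\<close>

lemma route_rev:
  assumes "route d w t lo hi I f g" and lo: "lo \<ge> 1" "hi \<le> w" "d > 0" "lo \<le> hi"
  shows "route d w t lo hi I g f"
proof -
  let ?G = "BEC d w t"
  define \<phi> :: "point \<times> nat \<Rightarrow> point \<times> nat" where "\<phi> v = at_height d (lo + hi - fst v d) v" for v
  obtain U where U: "disjoint_family_on U I"
    "\<And>e v. e \<in> I \<Longrightarrow> v \<in> U e \<Longrightarrow> lo \<le> fst v d \<and> fst v d \<le> hi"
    "\<And>e. e \<in> I \<Longrightarrow> linked ?G (U e) (at_height d lo (f e)) (at_height d hi (g e))"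
    using assms(1) unfolding route_def by blast
  have \<phi>\<phi>: "\<phi> (\<phi> v) = v" if "lo \<le> fst v d" "fst v d \<le> hi" for v
    using that by (cases v) (auto simp: \<phi>_def at_height_def)
  have pv: "\<phi> v \<in> pverts ?G" if "v \<in> pverts ?G" "lo \<le> fst v d" "fst v d \<le> hi" for v
    using that lo by (auto simp: \<phi>_def at_height_def pverts_BEC intro!: grid_points_upd)
  have arc: "(\<phi> u, \<phi> v) \<in> parcs ?G"
    if "(u, v) \<in> parcs ?G" "lo \<le> fst u d" "fst u d \<le> hi" "lo \<le> fst v d" "fst v d \<le> hi" for u v
  proof -
    have uv: "u \<in> pverts ?G" "v \<in> pverts ?G"
      using that(1) by (auto simp: BEC_def blowup_def)
    \<comment> \<open>The reflection only changes the sign of the difference in coordinate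
      \<open>d\<close>. Natural subtraction is exact here because both heights lie between
      \<open>lo\<close> and \<open>hi\<close>.\<close>
    have "(\<Sum>i\<in>{1..d}. (real (fst (\<phi> u) i) - real (fst (\<phi> v) i))\<^sup>2) =
        (\<Sum>i\<in>{1..d}. (real (fst u i) - real (fst v i))\<^sup>2)"
      using that by (intro sum.cong) (auto simp: \<phi>_def at_height_def of_nat_diff power2_eq_square algebra_simps)
    then have "euclidean_dist d (fst (\<phi> u)) (fst (\<phi> v)) = euclidean_dist d (fst u) (fst v)"
      by (simp add: euclidean_dist_def L2_set_def)
    moreover have "\<phi> u \<noteq> \<phi> v" 
    proof
      assume "\<phi> u = \<phi> v"
      then have "u = v" using \<phi>\<phi> that by metis
      then show False using that(1) by (simp add: BEC_def blowup_def)
    qed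
    moreover have "fst u = fst v \<Longrightarrow> fst (\<phi> u) = fst (\<phi> v)" by (simp add: \<phi>_def at_height_def)
    ultimately show ?thesis using that(1) pv[OF uv(1) that(2,3)] pv[OF uv(2) that(4,5)]
      by (auto simp: BEC_def blowup_def EC_def)
  qed
  have "linked ?G (\<phi> ` U e) (at_height d lo (g e)) (at_height d hi (f e))" if e: "e \<in> I" for e
  proof -
    have "\<phi> (at_height d lo (f e)) \<in> pverts ?G"
      using U(3)[OF e] lo by (intro pv) (auto simp: linked_def at_height_def)
    then have "linked ?G (\<phi> ` U e) (\<phi> (at_height d lo (f e))) (\<phi> (at_height d hi (g e)))"
      using U(2)[OF e] by (intro linked_map[OF U(3)[OF e]] arc) auto
    then show ?thesis using linked_sym[OF pair_graph_BEC] by (force simp: \<phi>_def at_height_def)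
  qed
  moreover have "disjoint_family_on (\<lambda>e. \<phi> ` U e) I"
    unfolding disjoint_family_on_def
  proof (intro ballI impI)
    fix a b assume ab: "a \<in> I" "b \<in> I" "a \<noteq> b"
    have "u \<in> U b" if "u \<in> U a" "v \<in> U b" "\<phi> u = \<phi> v" for u v
      using that \<phi>\<phi>[of u] \<phi>\<phi>[of v] U(2) ab by metis
    moreover have "U a \<inter> U b = {}" using U(1) ab by (auto simp: disjoint_family_on_def)
    ultimately show "\<phi> ` U a \<inter> \<phi> ` U b = {}" by blast
  qed
  moreover have "\<forall>v\<in>\<phi> ` U e. lo \<le> fst v d \<and> fst v d \<le> hi" if "e \<in> I" for e
  proof
    fix v assume "v \<in> \<phi> ` U e"
    then obtain u where "v = \<phi> u" "u \<in> U e" by blast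
    with U(2)[OF that, of u] show "lo \<le> fst v d \<and> fst v d \<le> hi"
      by (auto simp: \<phi>_def at_height_def)
  qed
  ultimately show ?thesis by (intro routeI)
qed

section \<open>Changing one coordinate of all paths inside one slab\<close>

lemma slice_iff:
  assumes "d \<ge> 1"
  shows "x \<in> slice d w h \<longleftrightarrow> x \<in> extensional {1..d} \<and> x d = h \<and> (\<forall>l\<in>{1..<d}. x l \<in> {1..w})"
proof -
  have "(\<forall>l\<in>{1..d}. P l) \<longleftrightarrow> P d \<and> (\<forall>l\<in>{1..<d}. P l)" for P
    using assms by (metis atLeastLessThan_iff atLeastAtMost_iff le_less order_refl)
  then show ?thesis unfolding slice_def PiE_iff by auto
qed

lemma slice_grid: "x \<in> slice d w 1 \<Longrightarrow> w \<ge> 1 \<Longrightarrow> x \<in> grid_points d w"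
  unfolding slice_def grid_points_def PiE_iff by (smt (verit) atLeastAtMost_iff order_refl singletonD)

text \<open>
  Climb to height \<open>r\<close>, step by \<open>\<delta>\<close> in direction \<open>j'\<close>, move in direction \<open>j\<close>, step back and climb on.
  The copy \<open>snd v\<close> is exchanged for \<open>snd v'\<close> when stepping back.
\<close>

definition track :: "nat \<Rightarrow> nat \<Rightarrow> nat \<Rightarrow> nat \<Rightarrow> nat \<Rightarrow> nat \<Rightarrow> nat \<Rightarrow> point \<times> nat \<Rightarrow> point \<times> nat \<Rightarrow>
    (point \<times> nat) set" where
  "track d lo hi j j' \<delta> r v v' =
     {z. snd z = snd v \<and> (\<forall>l. l \<noteq> d \<longrightarrow> fst z l = fst v l) \<and> lo \<le> fst z d \<and> fst z d \<le> r} \<union>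
     {z. snd z = snd v \<and> (\<forall>l. l \<noteq> d \<longrightarrow> l \<noteq> j \<longrightarrow> l \<noteq> j' \<longrightarrow> fst z l = fst v l) \<and>
         fst z j' = fst v j' + \<delta> \<and> fst z d = r \<and>
         min (fst v j) (fst v' j) \<le> fst z j \<and> fst z j \<le> max (fst v j) (fst v' j)} \<union>
     {z. snd z = snd v' \<and> (\<forall>l. l \<noteq> d \<longrightarrow> fst z l = fst v' l) \<and> r \<le> fst z d \<and> fst z d \<le> hi}"

lemma linked_track:
  assumes v: "v \<in> slice d w 1 \<times> {1..t}" "v' \<in> slice d w 1 \<times> {1..t}"
    and v': "fst v' = (fst v)(j := fst v' j)"
    and j: "j \<in> {1..<d}" "j' \<in> {1..<d}" "j \<noteq> j'" and \<delta>: "\<delta> \<le> 1" "fst v j' + \<delta> \<le> w"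
    and h: "1 \<le> lo" "lo \<le> r" "r \<le> hi" "hi \<le> w"
  shows "linked (BEC d w t) (track d lo hi j j' \<delta> r v v') (at_height d lo v) (at_height d hi v')"
proof -
  obtain x i y k where vv: "v = (x, i)" "v' = (y, k)" by (metis surj_pair)
  let ?W = "track d lo hi j j' \<delta> r v v'" and ?G = "BEC d w t"
  have d: "d \<in> {1..d}" "j \<in> {1..d}" "j' \<in> {1..d}" "d \<noteq> j" "d \<noteq> j'" using j by auto
  have xy: "x \<in> grid_points d w" "y \<in> grid_points d w" "i \<in> {1..t}" "k \<in> {1..t}"
    using v h vv by (auto intro!: slice_grid)
  have yx: "y = x(j := y j)" using v' vv by simp
  have b: "x j \<in> {1..w}" "y j \<in> {1..w}" "x j' \<in> {1..w}"
    using xy d by (auto simp: grid_points_def PiE_iff)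
  define z where "z = x(d := r, j' := x j' + \<delta>)"
  have g: "x(d := r) \<in> grid_points d w" "y(d := r) \<in> grid_points d w" "z \<in> grid_points d w"
    unfolding z_def using h b \<delta> vv d by (auto intro!: grid_points_upd xy simp del: fun_upd_apply)
  have gz: "z(j := y j) \<in> grid_points d w"
    using g(3) d b by (intro grid_points_upd)
  have z: "z(j := x j) = z" using d j by (auto simp: z_def)
  have 1: "linked ?G ?W (x(d := lo), i) (x(d := r), i)"
    using h xy d by (intro linked_segment) (auto simp: track_def vv)
  have 2: "linked ?G ?W (x(d := r), i) (z, i)"
  proof (rule linked_step)
    show "(x(d := r), i) = (z, i) \<or> ((x(d := r), i), (z, i)) \<in> parcs ?G"
      using g d \<delta> xy by (intro BEC_near[of _ _ _ _ j']) (auto simp: z_def)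
  qed (use g xy h d j in \<open>auto simp: track_def vv pverts_BEC z_def\<close>)
  have 3: "linked ?G ?W (z(j := x j), i) (z(j := y j), i)"
    using h xy d b g j by (intro linked_segment) (auto simp: track_def vv z_def)
  \<comment> \<open>A single step both leaves the detour layer and changes the copy. For
    \<open>\<delta> = 0\<close> the point stays the same and at most the copy changes.\<close>
  have 4: "linked ?G ?W (z(j := y j), i) (y(d := r), k)"
  proof (rule linked_step)
    have "y l = x l" if "l \<noteq> j" for l using yx that by (metis fun_upd_other)
    then show "(z(j := y j), i) = (y(d := r), k) \<or> ((z(j := y j), i), (y(d := r), k)) \<in> parcs ?G"
      using g gz d \<delta> xy j by (intro BEC_near[of _ _ _ _ j']) (auto simp: z_def)
    show "(z(j := y j), i) \<in> ?W"
      using j d by (auto simp: track_def vv z_def)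
    show "(y(d := r), k) \<in> ?W"
      using h by (auto simp: track_def vv)
  qed (use gz xy in \<open>auto simp: pverts_BEC\<close>)
  have 5: "linked ?G ?W (y(d := r), k) (y(d := hi), k)"
    using h xy d by (intro linked_segment) (auto simp: track_def vv)
  show ?thesis
    using 1 2 3 4 5 unfolding z at_height_def vv fst_conv snd_conv by (meson linked_trans)
qed

lemma track_cases:
  assumes "z \<in> track d lo hi j j' \<delta> r v v'"
  obtains (src) "snd z = snd v" "\<And>l. l \<noteq> d \<Longrightarrow> fst z l = fst v l" "fst z d \<le> r"
  | (turn) "snd z = snd v" "\<And>l. l \<noteq> d \<Longrightarrow> l \<noteq> j \<Longrightarrow> l \<noteq> j' \<Longrightarrow> fst z l = fst v l"
      "fst z j' = fst v j' + \<delta>" "fst z d = r"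
      "min (fst v j) (fst v' j) \<le> fst z j" "fst z j \<le> max (fst v j) (fst v' j)"
  | (dst) "snd z = snd v'" "\<And>l. l \<noteq> d \<Longrightarrow> fst z l = fst v' l" "r \<le> fst z d"
proof -
  from assms consider
    "snd z = snd v" "\<forall>l. l \<noteq> d \<longrightarrow> fst z l = fst v l" "fst z d \<le> r"
  | "snd z = snd v" "\<forall>l. l \<noteq> d \<longrightarrow> l \<noteq> j \<longrightarrow> l \<noteq> j' \<longrightarrow> fst z l = fst v l"
      "fst z j' = fst v j' + \<delta>" "fst z d = r"
      "min (fst v j) (fst v' j) \<le> fst z j" "fst z j \<le> max (fst v j) (fst v' j)"
  | "snd z = snd v'" "\<forall>l. l \<noteq> d \<longrightarrow> fst z l = fst v' l" "r \<le> fst z d"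
    unfolding track_def Un_iff mem_Collect_eq by argo
  then show thesis
  proof cases
    case 1 then show thesis by (intro src) simp_all
  next
    case 2 then show thesis by (intro turn) simp_all
  next
    case 3 then show thesis by (intro dst) simp_all
  qed
qed

lemma track_height:
  "lo \<le> r \<Longrightarrow> r \<le> hi \<Longrightarrow> z \<in> track d lo hi j j' \<delta> r v v' \<Longrightarrow> lo \<le> fst z d \<and> fst z d \<le> hi"
  by (auto simp: track_def)

lemma slice_eqI:
  assumes "v \<in> slice d w 1 \<times> T" "v' \<in> slice d w 1 \<times> T" "d \<ge> 1" "snd v = snd v'"
    and "\<And>l. l \<noteq> d \<Longrightarrow> fst v l = fst v' l"
  shows "v = v'"
proof (rule prod_eqI)
  show "fst v = fst v'"
  proof
    show "fst v l = fst v' l" for l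
      using assms by (cases "l = d") (auto simp: slice_iff mem_Times_iff)
  qed
qed (fact assms)

text \<open>Parity separates the three phases of a track. Before the move coordinate
  \<open>j\<close> is odd, after it \<open>j\<close> is even, and on the detour coordinate
  \<open>j'\<close> has the parity opposite to the one common to all paths. Hence two tracks can
  only meet in the same phase, where injectivity of \<open>f\<close> or of \<open>g\<close> excludes
  it.\<close>

lemma route_permute:
  assumes fg: "f \<in> I \<rightarrow> slice d w 1 \<times> {1..t}" "g \<in> I \<rightarrow> slice d w 1 \<times> {1..t}"
    and inj: "inj_on f I" "inj_on g I"
    and upd: "\<And>e. e \<in> I \<Longrightarrow> fst (g e) = (fst (f e))(j := fst (g e) j)"
    and j: "j \<in> {1..<d}" "j' \<in> {1..<d}" "j \<noteq> j'"
    and par: "\<And>e. e \<in> I \<Longrightarrow> odd (fst (f e) j)" "\<And>e. e \<in> I \<Longrightarrow> even (fst (g e) j)"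
      "\<And>e. e \<in> I \<Longrightarrow> even (fst (f e) j') = \<beta>"
    and bd: "\<And>e. e \<in> I \<Longrightarrow> fst (f e) j' < w" "\<And>e. e \<in> I \<Longrightarrow> lo + fst (f e) j \<le> hi"
    and h: "1 \<le> lo" "hi \<le> w"
  shows "route d w t lo hi I f g"
proof (rule routeI)
  \<comment> \<open>The turning height records the old coordinate, so paths sharing a line of the detour layer turn at different heights.\<close>
  let ?W = "\<lambda>e. track d lo hi j j' 1 (lo + fst (f e) j) (f e) (g e)"
  show "linked (BEC d w t) (?W e) (at_height d lo (f e)) (at_height d hi (g e))" if "e \<in> I" for e
    using fg that j h bd[OF that] upd[OF that] by (intro linked_track) auto
  show "\<forall>v\<in>?W e. lo \<le> fst v d \<and> fst v d \<le> hi" if "e \<in> I" for e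
    using track_height bd(2)[OF that] by (meson le_add1)
  have d: "d \<ge> 1" "d \<noteq> j" "d \<noteq> j'" using j by auto
  show "disjoint_family_on ?W I"
    unfolding disjoint_family_on_def
  proof (intro ballI impI, rule ccontr)
    fix a b assume ab: "a \<in> I" "b \<in> I" "a \<noteq> b" and "?W a \<inter> ?W b \<noteq> {}"
    then obtain z where z: "z \<in> ?W a" "z \<in> ?W b" by blast
    have f: "\<not> (snd (f a) = snd (f b) \<and> (\<forall>l. l \<noteq> d \<longrightarrow> fst (f a) l = fst (f b) l))"
      using slice_eqI[of "f a" d w "{1..t}" "f b"] fg ab inj(1) d by (auto dest: inj_onD)
    have g: "\<not> (snd (g a) = snd (g b) \<and> (\<forall>l. l \<noteq> d \<longrightarrow> fst (g a) l = fst (g b) l))"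
      using slice_eqI[of "g a" d w "{1..t}" "g b"] fg ab inj(2) d by (auto dest: inj_onD)
    have gj: "fst (g e) j' = fst (f e) j'" if "e \<in> I" for e
      using upd[OF that] j by (metis fun_upd_other)
    have t: "snd z = snd (f e) \<and> (\<forall>l. l \<noteq> d \<longrightarrow> fst z l = fst (f e) l) \<and> odd (fst z j) \<and> even (fst z j') = \<beta> \<or>
        snd z = snd (g e) \<and> (\<forall>l. l \<noteq> d \<longrightarrow> fst z l = fst (g e) l) \<and> even (fst z j) \<and> even (fst z j') = \<beta> \<or>
        snd z = snd (f e) \<and> (\<forall>l. l \<noteq> d \<longrightarrow> l \<noteq> j \<longrightarrow> l \<noteq> j' \<longrightarrow> fst z l = fst (f e) l) \<and>
          fst z j' = fst (f e) j' + 1 \<and> fst z d = lo + fst (f e) j \<and> even (fst z j') = (\<not> \<beta>)"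
      if "z \<in> ?W e" "e \<in> I" for e
      using that(1)
    proof (cases rule: track_cases)
      case src
      then show ?thesis using src(2)[OF d(2)[symmetric]] src(2)[OF d(3)[symmetric]] par[OF that(2)] by simp
    next
      case turn
      then show ?thesis using par[OF that(2)] by simp
    next
      case dst
      then show ?thesis
        using dst(2)[OF d(2)[symmetric]] dst(2)[OF d(3)[symmetric]] par[OF that(2)] gj[OF that(2)] by simp
    qed
    \<comment> \<open>A detour vertex determines its path: the height yields the old coordinate
      \<open>j\<close>, the layer yields \<open>j'\<close>, and all other coordinates are
      unchanged.\<close>
    have diag: "\<forall>l. l \<noteq> d \<longrightarrow> fst (f a) l = fst (f b) l"
      if "\<forall>l. l \<noteq> d \<longrightarrow> l \<noteq> j \<longrightarrow> l \<noteq> j' \<longrightarrow> fst z l = fst (f a) l"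
        "\<forall>l. l \<noteq> d \<longrightarrow> l \<noteq> j \<longrightarrow> l \<noteq> j' \<longrightarrow> fst z l = fst (f b) l"
        "fst z j' = fst (f a) j' + 1" "fst z j' = fst (f b) j' + 1"
        "fst z d = lo + fst (f a) j" "fst z d = lo + fst (f b) j"
    proof (intro allI impI)
      fix l assume "l \<noteq> d"
      then show "fst (f a) l = fst (f b) l"
        using that by (cases "l = j"; cases "l = j'") auto
    qed
    note ta = t[OF z(1) ab(1)] and tb = t[OF z(2) ab(2)]
    consider "even (fst z j') \<noteq> \<beta>" | "even (fst z j') = \<beta>" "odd (fst z j)" |
      "even (fst z j') = \<beta>" "even (fst z j)" by blast
    then show False
    proof cases
      case 1
      then show ?thesis using ta tb f diag by argo
    next
      case 2
      then have "snd z = snd (f a)" "\<forall>l. l \<noteq> d \<longrightarrow> fst z l = fst (f a) l"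
        "snd z = snd (f b)" "\<forall>l. l \<noteq> d \<longrightarrow> fst z l = fst (f b) l"
        using ta tb by blast+
      then show ?thesis using f by simp
    next
      case 3
      then have "snd z = snd (g a)" "\<forall>l. l \<noteq> d \<longrightarrow> fst z l = fst (g a) l"
        "snd z = snd (g b)" "\<forall>l. l \<noteq> d \<longrightarrow> fst z l = fst (g b) l"
        using ta tb by blast+
      then show ?thesis using g by simp
    qed
  qed
qed

text \<open>On positive numbers \<open>2 * x - 1\<close> is increasing and never below
  \<open>x\<close>, so the order of the paths along direction \<open>j\<close> is kept and they can
  move outwards one after the other. Paths starting with equal \<open>j\<close>-th coordinate differ
  in another coordinate or in the copy, and these stay fixed.\<close>

lemma route_expand:
  assumes fg: "f \<in> I \<rightarrow> slice d w 1 \<times> {1..t}" "g \<in> I \<rightarrow> slice d w 1 \<times> {1..t}"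
    and inj: "inj_on f I"
    and upd: "\<And>e. e \<in> I \<Longrightarrow> fst (g e) = (fst (f e))(j := 2 * fst (f e) j - 1)"
      "\<And>e. e \<in> I \<Longrightarrow> snd (g e) = snd (f e)"
    and j: "j \<in> {1..<d}" and d3: "d \<ge> 3"
    and bd: "\<And>e. e \<in> I \<Longrightarrow> fst (f e) j \<le> N" and hi: "lo + N \<le> hi"
    and h: "1 \<le> lo" "hi \<le> w"
  shows "route d w t lo hi I f g"
proof (rule routeI)
  \<comment> \<open>Any direction other than \<open>j\<close> and \<open>d\<close> will do, since
    with \<open>\<delta> = 0\<close> the path turns within its own layer.\<close>
  define j' where "j' = (if j = 1 then 2 else 1 :: nat)"
  have j': "j' \<in> {1..<d}" "j \<noteq> j'" using d3 by (auto simp: j'_def)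
  \<comment> \<open>Outer paths turn first, clearing the way for the inner ones; no detour is needed.\<close>
  let ?W = "\<lambda>e. track d lo hi j j' 0 (lo + (N - fst (f e) j)) (f e) (g e)"
  have pos: "fst (f e) j \<ge> 1" if "e \<in> I" for e
    using fg that j d3 by (fastforce simp: slice_iff Pi_iff mem_Times_iff)
  have le: "fst (f e) j' \<le> w" if "e \<in> I" for e
    using fg that j' d3 by (fastforce simp: slice_iff Pi_iff mem_Times_iff)
  show "linked (BEC d w t) (?W e) (at_height d lo (f e)) (at_height d hi (g e))" if "e \<in> I" for e
    using fg that j j' h le[OF that] bd[OF that] hi upd(1)[OF that] by (intro linked_track) auto
  show "\<forall>v\<in>?W e. lo \<le> fst v d \<and> fst v d \<le> hi" if "e \<in> I" for e
    by (rule ballI, rule track_height[of lo "lo + (N - fst (f e) j)"]) (use hi in auto)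
  have d: "d \<ge> 1" "d \<noteq> j" "d \<noteq> j'" using j j' by auto
  have lt: "?W a \<inter> ?W b = {}" if ab: "a \<in> I" "b \<in> I" and "fst (f a) j < fst (f b) j" for a b
  proof (rule ccontr)
    assume "?W a \<inter> ?W b \<noteq> {}"
    then obtain z where z: "z \<in> ?W a" "z \<in> ?W b" by blast
    have "fst (g a) j = 2 * fst (f a) j - 1" "fst (g b) j = 2 * fst (f b) j - 1"
      using upd ab by (metis fun_upd_same)+
    moreover have "fst z j = fst (f e) j \<and> fst z d \<le> lo + (N - fst (f e) j) \<or>
        fst z j = fst (g e) j \<and> lo + (N - fst (f e) j) \<le> fst z d \<or>
        min (fst (f e) j) (fst (g e) j) \<le> fst z j \<and> fst z j \<le> max (fst (f e) j) (fst (g e) j) \<and>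
        fst z d = lo + (N - fst (f e) j)"
      if "z \<in> ?W e" for e
      using that by (cases rule: track_cases) (use d in auto)
    note this[OF z(1)] this[OF z(2)]
    ultimately show False
      using pos[OF ab(1)] pos[OF ab(2)] bd[OF ab(1)] bd[OF ab(2)] that(3) by auto
  qed
  show "disjoint_family_on ?W I"
    unfolding disjoint_family_on_def
  proof (intro ballI impI)
    fix a b assume ab: "a \<in> I" "b \<in> I" "a \<noteq> b"
    show "?W a \<inter> ?W b = {}"
    proof (cases "fst (f a) j = fst (f b) j")
      case False
      then show ?thesis using lt[of a b] lt[of b a] ab by (metis Int_commute nat_neq_iff)
    next
      case True
      show ?thesis
      proof (rule ccontr)
        assume "?W a \<inter> ?W b \<noteq> {}"
        then obtain z where z: "z \<in> ?W a" "z \<in> ?W b" by blast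
        have t: "snd z = snd (f e) \<and> (\<forall>l. l \<noteq> d \<longrightarrow> l \<noteq> j \<longrightarrow> fst z l = fst (f e) l)"
          if "z \<in> ?W e" "e \<in> I" for e
          using that(1)
        proof (cases rule: track_cases)
          case turn
          then show ?thesis by (metis add_0_right)
        qed (use upd[OF that(2)] in auto)
        have "fst (f a) l = fst (f b) l" if "l \<noteq> d" for l
          using t[OF z(1) ab(1)] t[OF z(2) ab(2)] True that by (cases "l = j") auto
        then have "f a = f b"
          using t[OF z(1) ab(1)] t[OF z(2) ab(2)] fg ab d
          by (intro slice_eqI[of _ d w "{1..t}"]) auto
        then show False using inj ab by (auto dest: inj_onD)
      qed
    qed
  qed
qed

section \<open>Choosing the intermediate points by colouring\<close>

text \<open>Fewer than \<open>N\<close> coloured elements conflict with a newly added one, so a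
  colour is left for it. Symmetry of \<open>R\<close> makes this count cover conflicts in both
  directions.\<close>

lemma greedy_colouring:
  assumes "finite M" and "symp R" and "\<And>e. e \<in> M \<Longrightarrow> card {e' \<in> M. e' \<noteq> e \<and> R e e'} < N"
  shows "\<exists>c. c ` M \<subseteq> {1..N::nat} \<and> (\<forall>e\<in>M. \<forall>e'\<in>M. e \<noteq> e' \<longrightarrow> R e e' \<longrightarrow> c e \<noteq> c e')"
  using assms(1,3)
proof (induction M)
  case (insert a M)
  have "card {e' \<in> M. e' \<noteq> e \<and> R e e'} < N" if "e \<in> M" for e
  proof -
    have "card {e' \<in> M. e' \<noteq> e \<and> R e e'} \<le> card {e' \<in> insert a M. e' \<noteq> e \<and> R e e'}"
      using insert.hyps by (intro card_mono) auto
    then show ?thesis using insert.prems[of e] that by simp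
  qed
  then obtain c where c: "c ` M \<subseteq> {1..N}" "\<forall>e\<in>M. \<forall>e'\<in>M. e \<noteq> e' \<longrightarrow> R e e' \<longrightarrow> c e \<noteq> c e'"
    using insert.IH by blast
  let ?B = "c ` {e' \<in> M. R a e'}"
  have "card ?B \<le> card {e' \<in> M. R a e'}" using insert.hyps by (intro card_image_le) auto
  moreover have "{e' \<in> M. R a e'} = {e' \<in> insert a M. e' \<noteq> a \<and> R a e'}" using insert.hyps by auto
  ultimately have "card ?B < card {1..N}" using insert.prems[of a] by simp
  moreover have "finite ?B" using insert.hyps by simp
  ultimately have "\<not> {1..N} \<subseteq> ?B" using card_mono[of ?B "{1..N}"] by linarith
  then obtain y where y: "y \<in> {1..N}" "y \<notin> ?B" by blast
  let ?c = "c(a := y)"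
  have "?c ` insert a M \<subseteq> {1..N}" using c(1) y(1) insert.hyps by auto
  moreover have "?c e \<noteq> ?c e'" if "e \<in> insert a M" "e' \<in> insert a M" "e \<noteq> e'" "R e e'" for e e'
  proof -
    have "R e' e" using \<open>symp R\<close> that(4) by (rule sympD)
    then show ?thesis using that c(2) y(2) by (cases "e = a"; cases "e' = a") auto
  qed
  ultimately show ?case by (intro exI[of _ ?c]) blast
qed simp

text \<open>
  \<open>c e l\<close> is the \<open>l\<close>-th coordinate of the intermediate point of \<open>e\<close>, and \<open>\<kappa> j e\<close> is the copy used after
  \<open>j\<close> coordinates have been moved.
\<close>

definition mixed :: "('m \<Rightarrow> nat \<Rightarrow> nat) \<Rightarrow> (nat \<Rightarrow> 'm \<Rightarrow> nat) \<Rightarrow> ('m \<Rightarrow> point \<times> nat) \<Rightarrow> nat \<Rightarrow> 'm \<Rightarrow> point \<times> nat"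
  where "mixed c \<kappa> X j e = ((\<lambda>l. if l \<in> {1..j} then c e l else fst (X e) l), \<kappa> j e)"

text \<open>This is the degree bound for the colouring. Elements with the same value of
  \<open>D\<close> can differ only in the erased coordinate \<open>Suc j\<close>, which still has
  its original value in \<open>{1..n}\<close>. So there are at most \<open>n\<close> of them, and
  omitting \<open>e\<close> itself makes the bound strict.\<close>

lemma card_fibre_less:
  assumes X: "X \<in> M \<rightarrow> slice d n 1 \<times> T" and j: "Suc j \<in> {1..<d}" "d \<ge> 1"
    and inj: "inj_on (mixed c (\<lambda>_ e. snd (X e)) X j) M" and "e \<in> M"
  defines "D \<equiv> \<lambda>e. ((fst (mixed c (\<lambda>_ e. snd (X e)) X j e))(Suc j := 0), snd (X e))"
  shows "card {e' \<in> M. e' \<noteq> e \<and> D e' = D e} < n"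
proof -
  let ?F = "{e' \<in> M. D e' = D e}"
  have "inj_on (\<lambda>e'. fst (X e') (Suc j)) ?F"
  proof (rule inj_onI)
    fix a b assume ab: "a \<in> ?F" "b \<in> ?F" "fst (X a) (Suc j) = fst (X b) (Suc j)"
    then have D: "D a = D b" by simp
    have "mixed c (\<lambda>_ e. snd (X e)) X j a = mixed c (\<lambda>_ e. snd (X e)) X j b"
    proof (rule prod_eqI)
      show "fst (mixed c (\<lambda>_ e. snd (X e)) X j a) = fst (mixed c (\<lambda>_ e. snd (X e)) X j b)"
      proof
        fix l
        have "fst (D a) l = fst (D b) l" using D by simp
        then show "fst (mixed c (\<lambda>_ e. snd (X e)) X j a) l = fst (mixed c (\<lambda>_ e. snd (X e)) X j b) l"
          using ab(3) by (cases "l = Suc j") (simp_all add: D_def mixed_def)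
      qed
      show "snd (mixed c (\<lambda>_ e. snd (X e)) X j a) = snd (mixed c (\<lambda>_ e. snd (X e)) X j b)"
        using D by (simp add: D_def mixed_def)
    qed
    then show "a = b" using inj ab by (auto dest: inj_onD)
  qed
  moreover have im: "(\<lambda>e'. fst (X e') (Suc j)) ` ?F \<subseteq> {1..n}"
  proof (rule image_subsetI)
    fix a assume "a \<in> ?F"
    then have "fst (X a) \<in> slice d n 1" using X by (auto simp: Pi_iff mem_Times_iff)
    then show "fst (X a) (Suc j) \<in> {1..n}" using j slice_iff[of d "fst (X a)" n 1] by blast
  qed
  ultimately have fin: "finite ?F" and "card ?F \<le> n"
    using inj_on_finite[of _ ?F "{1..n}"] card_inj_on_le[of _ ?F "{1..n}"] by auto
  moreover have "{e' \<in> M. e' \<noteq> e \<and> D e' = D e} \<subset> ?F" using \<open>e \<in> M\<close> by auto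
  ultimately show ?thesis using psubset_card_mono[OF fin] by (meson less_le_trans)
qed

text \<open>Points that collide after the move have equal new coordinates \<open>col\<close> and
  agree once coordinate \<open>Suc j\<close> is erased, which is the situation the assumption
  forbids.\<close>

lemma mixed_Suc_inj:
  assumes "\<And>a b. a \<in> M \<Longrightarrow> b \<in> M \<Longrightarrow> a \<noteq> b \<Longrightarrow>
      ((fst (mixed c \<kappa> X j a))(Suc j := 0), \<kappa>' a) = ((fst (mixed c \<kappa> X j b))(Suc j := 0), \<kappa>' b) \<Longrightarrow>
      col a \<noteq> col b"
  shows "inj_on (mixed (\<lambda>e. (c e)(Suc j := col e)) (\<lambda>_. \<kappa>') X (Suc j)) M"
proof (rule inj_onI, rule ccontr)
  let ?m = "mixed (\<lambda>e. (c e)(Suc j := col e)) (\<lambda>_. \<kappa>') X (Suc j)"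
  fix a b assume ab: "a \<in> M" "b \<in> M" "?m a = ?m b" "a \<noteq> b"
  have l: "fst (?m a) l = fst (?m b) l" for l using ab(3) by simp
  have "col a = col b" using l[of "Suc j"] by (simp add: mixed_def)
  moreover have "(fst (mixed c \<kappa> X j a))(Suc j := 0) = (fst (mixed c \<kappa> X j b))(Suc j := 0)"
  proof
    fix i show "((fst (mixed c \<kappa> X j a))(Suc j := 0)) i = ((fst (mixed c \<kappa> X j b))(Suc j := 0)) i"
      using l[of i] by (cases "i = Suc j") (auto simp: mixed_def le_Suc_eq split: if_splits)
  qed
  moreover have "\<kappa>' a = \<kappa>' b" using ab(3) by (simp add: mixed_def)
  ultimately show False using assms[OF ab(1,2,4)] by simp
qed

lemma mixed_upd:
  "i \<le> j \<Longrightarrow> mixed (\<lambda>e. (c e)(Suc j := col e)) \<kappa> X i = mixed c \<kappa> X i"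
  by (intro ext prod_eqI) (auto simp: mixed_def)

lemma exists_intermediate:
  assumes "finite M" and XY: "X \<in> M \<rightarrow> slice d n 1 \<times> T" "Y \<in> M \<rightarrow> slice d n 1 \<times> T"
    and inj: "inj_on X M" "inj_on Y M" and "n > 0"
    and "k < d"
  shows "\<exists>c. (\<forall>e\<in>M. \<forall>l\<in>{1..k}. c e l \<in> {1..2 * n}) \<and>
    (\<forall>j\<le>k. inj_on (mixed c (\<lambda>_ e. snd (X e)) X j) M \<and> inj_on (mixed c (\<lambda>_ e. snd (Y e)) Y j) M)"
  using \<open>k < d\<close>
proof (induction k)
  case 0
  have "mixed (\<lambda>_ _. 0) (\<lambda>_ e. snd (Z e)) Z 0 = Z" for Z :: "'a \<Rightarrow> point \<times> nat"
    by (intro ext prod_eqI) (auto simp: mixed_def)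
  then show ?case using inj by (intro exI[of _ "\<lambda>_ _. 0"]) simp
next
  case (Suc k)
  then obtain c where c: "\<forall>e\<in>M. \<forall>l\<in>{1..k}. c e l \<in> {1..2 * n}"
    "\<forall>j\<le>k. inj_on (mixed c (\<lambda>_ e. snd (X e)) X j) M \<and> inj_on (mixed c (\<lambda>_ e. snd (Y e)) Y j) M"
    by auto
  \<comment> \<open>Coordinate \<open>Suc k\<close>, about to be replaced, is erased by setting it
    to 0. Elements with equal \<open>D\<close> collide after the move exactly when they receive the
    same new coordinate.\<close>
  define D where "D Z e = ((fst (mixed c (\<lambda>_ e. snd (Z e)) Z k e))(Suc k := 0), snd (Z e))"
    for Z :: "'a \<Rightarrow> point \<times> nat" and e
  \<comment> \<open>Each \<open>e\<close> is an edge of a bipartite multigraph, joining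
    \<open>D X e\<close> on one side to \<open>D Y e\<close> on the other, and \<open>R\<close> says
    that two edges share an end. A proper edge colouring thus serves both ends of the matching with
    one common new coordinate.\<close>
  define R where "R e e' \<longleftrightarrow> D X e' = D X e \<or> D Y e' = D Y e" for e e'
  have j: "Suc k \<in> {1..<d}" "d \<ge> 1" using Suc.prems by auto
  have "\<exists>col. col ` M \<subseteq> {1..2 * n} \<and> (\<forall>e\<in>M. \<forall>e'\<in>M. e \<noteq> e' \<longrightarrow> R e e' \<longrightarrow> col e \<noteq> col e')"
  proof (rule greedy_colouring[OF \<open>finite M\<close>])
    show "symp R" by (auto simp: symp_def R_def)
    fix e assume e: "e \<in> M"
    have "card {e' \<in> M. e' \<noteq> e \<and> R e e'} =
        card ({e' \<in> M. e' \<noteq> e \<and> D X e' = D X e} \<union> {e' \<in> M. e' \<noteq> e \<and> D Y e' = D Y e})"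
      by (rule arg_cong[of _ _ card]) (auto simp: R_def)
    also have "\<dots> \<le> card {e' \<in> M. e' \<noteq> e \<and> D X e' = D X e} + card {e' \<in> M. e' \<noteq> e \<and> D Y e' = D Y e}"
      by (rule card_Un_le)
    also have "\<dots> < n + n"
      unfolding D_def using c(2) XY e by (intro add_strict_mono card_fibre_less[OF _ j]) auto
    finally show "card {e' \<in> M. e' \<noteq> e \<and> R e e'} < 2 * n" by simp
  qed
  then obtain col where col: "col ` M \<subseteq> {1..2 * n}"
    "\<And>e e'. e \<in> M \<Longrightarrow> e' \<in> M \<Longrightarrow> e \<noteq> e' \<Longrightarrow> R e e' \<Longrightarrow> col e \<noteq> col e'" by blast
  let ?c = "\<lambda>e. (c e)(Suc k := col e)"
  have "inj_on (mixed ?c (\<lambda>_ e. snd (X e)) X (Suc k)) M"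
    by (rule mixed_Suc_inj[where \<kappa> = "\<lambda>_ e. snd (X e)"]) (metis D_def R_def col(2))
  moreover have "inj_on (mixed ?c (\<lambda>_ e. snd (Y e)) Y (Suc k)) M"
    by (rule mixed_Suc_inj[where \<kappa> = "\<lambda>_ e. snd (Y e)"]) (metis D_def R_def col(2))
  ultimately have "\<forall>j\<le>Suc k. inj_on (mixed ?c (\<lambda>_ e. snd (X e)) X j) M \<and> inj_on (mixed ?c (\<lambda>_ e. snd (Y e)) Y j) M"
    using c(2) by (auto simp: le_Suc_eq mixed_upd)
  moreover have "\<forall>e\<in>M. \<forall>l\<in>{1..Suc k}. ?c e l \<in> {1..2 * n}"
    using c(1) col(1) by (auto simp: le_Suc_eq)
  ultimately show ?case by (intro exI[of _ ?c] conjI)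
qed

section \<open>Stacking slabs, one for each coordinate\<close>

lemma route_cong:
  assumes "route d w t lo hi I f g" "\<And>e. e \<in> I \<Longrightarrow> f e = f' e" "\<And>e. e \<in> I \<Longrightarrow> g e = g' e"
  shows "route d w t lo hi I f' g'"
  using assms by (simp add: route_def)

definition spread :: "('m \<Rightarrow> point \<times> nat) \<Rightarrow> nat \<Rightarrow> 'm \<Rightarrow> point \<times> nat" where
  "spread X s e = ((\<lambda>l. if l \<in> {1..s} then 2 * fst (X e) l - 1 else fst (X e) l), snd (X e))"

lemma route_spread:
  assumes X: "X \<in> M \<rightarrow> slice d n 1 \<times> {1..t}" "inj_on X M" and d: "d \<ge> 3" and n: "n > 0"
    and lo: "1 \<le> lo" "lo + (d - 1) * (5 * n) - 1 \<le> w"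
  shows "route d w t lo (lo + (d - 1) * (5 * n) - 1) M X (spread X (d - 1))"
proof -
  let ?L = "5 * n"
  have Xs: "fst (X e) l \<in> {1..n}" if "e \<in> M" "l \<in> {1..<d}" for e l
    using X(1) that d slice_iff[of d "fst (X e)" n 1] by (auto simp: Pi_iff mem_Times_iff)
  have Xd: "fst (X e) d = 1" "fst (X e) \<in> extensional {1..d}" "snd (X e) \<in> {1..t}" if "e \<in> M" for e
    using X(1) that d slice_iff[of d "fst (X e)" n 1] by (auto simp: Pi_iff mem_Times_iff)
  have w: "2 * n \<le> w"
  proof -
    have "1 * (5 * n) \<le> (d - 1) * (5 * n)" using d by (intro mult_right_mono) auto
    then show ?thesis using lo n by linarith
  qed
  have T: "spread X s \<in> M \<rightarrow> slice d w 1 \<times> {1..t}" if "s \<le> d - 1" for s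
  proof
    fix e assume e: "e \<in> M"
    have "fst (spread X s e) l \<in> {1..w}" if "l \<in> {1..<d}" for l
      using Xs[OF e that] w by (auto simp: spread_def)
    moreover have "fst (spread X s e) d = 1" "fst (spread X s e) \<in> extensional {1..d}"
      using Xd[OF e] that d by (auto simp: spread_def extensional_def)
    ultimately show "spread X s e \<in> slice d w 1 \<times> {1..t}"
      using slice_iff[of d "fst (spread X s e)" w 1] Xd[OF e] d
      by (auto simp: mem_Times_iff) (auto simp: spread_def)
  qed
  have inj: "inj_on (spread X s) M" if "s \<le> d - 1" for s
  proof (rule inj_onI)
    fix a b assume ab: "a \<in> M" "b \<in> M" "spread X s a = spread X s b"
    have "fst (X a) l = fst (X b) l" for l
    proof -
      have "fst (spread X s a) l = fst (spread X s b) l" using ab(3) by simp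
      then show ?thesis using Xs[OF ab(1), of l] Xs[OF ab(2), of l] that d
        by (cases "l \<in> {1..s}") (auto simp: spread_def)
    qed
    moreover have "snd (X a) = snd (X b)" using ab(3) by (simp add: spread_def)
    ultimately have "X a = X b" by (intro prod_eqI ext)
    then show "a = b" using X(2) ab by (auto dest: inj_onD)
  qed
  have "route d w t lo (lo + (d - 1) * ?L - 1) M (spread X 0) (spread X (d - 1))"
  proof (rule route_chain)
    fix s assume s: "s < d - 1"
    have "Suc s * ?L \<le> (d - 1) * ?L" using s by (intro mult_right_mono) auto
    then have hi: "lo + s * ?L + ?L - 1 \<le> w" using lo by simp
    show "route d w t (lo + s * ?L) (lo + s * ?L + ?L - 1) M (spread X s) (spread X (Suc s))"
    proof (rule route_expand[where j = "Suc s" and N = n])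
      fix e assume e: "e \<in> M"
      show "fst (spread X (Suc s) e) = (fst (spread X s e))(Suc s := 2 * fst (spread X s e) (Suc s) - 1)"
        by (auto simp: spread_def)
      show "fst (spread X s e) (Suc s) \<le> n" using Xs[OF e, of "Suc s"] s by (auto simp: spread_def)
    qed (use T inj s d lo hi n in \<open>auto simp: spread_def\<close>)
  qed (use d n in auto)
  then show ?thesis by (rule route_cong) (auto simp: spread_def)
qed

text \<open>Parity records progress: coordinates already moved are even, those still waiting are
  odd. This is what \<open>route_permute\<close> asks for.\<close>

definition spaced :: "nat \<Rightarrow> ('m \<Rightarrow> nat \<Rightarrow> nat) \<Rightarrow> (nat \<Rightarrow> 'm \<Rightarrow> nat) \<Rightarrow> ('m \<Rightarrow> point \<times> nat) \<Rightarrow>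
    nat \<Rightarrow> 'm \<Rightarrow> point \<times> nat" where
  "spaced d c \<kappa> X j e = ((\<lambda>l. if l \<in> {1..j} then 2 * c e l
     else if l \<in> {1..<d} then 2 * fst (X e) l - 1 else fst (X e) l), \<kappa> j e)"

lemma route_spaced:
  assumes X: "X \<in> M \<rightarrow> slice d n 1 \<times> {1..t}" and d: "d \<ge> 3" and n: "n > 0"
    and c: "\<And>e l. e \<in> M \<Longrightarrow> l \<in> {1..<d} \<Longrightarrow> c e l \<in> {1..2 * n}"
    and \<kappa>: "\<And>j e. e \<in> M \<Longrightarrow> \<kappa> j e \<in> {1..t}"
    and inj: "\<And>j. j \<le> d - 1 \<Longrightarrow> inj_on (mixed c \<kappa> X j) M"
    and lo: "1 \<le> lo" "lo + (d - 1) * (5 * n) - 1 \<le> w"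
  shows "route d w t lo (lo + (d - 1) * (5 * n) - 1) M (spaced d c \<kappa> X 0) (spaced d c \<kappa> X (d - 1))"
proof -
  let ?L = "5 * n" and ?S = "spaced d c \<kappa> X"
  have Xs: "fst (X e) l \<in> {1..n}" if "e \<in> M" "l \<in> {1..<d}" for e l
    using X that d slice_iff[of d "fst (X e)" n 1] by (auto simp: Pi_iff mem_Times_iff)
  have Xd: "fst (X e) d = 1" "fst (X e) \<in> extensional {1..d}" if "e \<in> M" for e
    using X that d slice_iff[of d "fst (X e)" n 1] by (auto simp: Pi_iff mem_Times_iff)
  \<comment> \<open>The inequality is strict because a detour goes one layer beyond a coordinate,
    which may be as large as \<open>4 * n\<close>.\<close>
  have w: "4 * n < w"
  proof -
    have "2 * (5 * n) \<le> (d - 1) * (5 * n)" using d by (intro mult_right_mono) auto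
    then show ?thesis using lo n by linarith
  qed
  have le: "fst (?S s e) l \<in> {1..4 * n}" if "e \<in> M" "l \<in> {1..<d}" for e l s
    using Xs[OF that] c[OF that] by (auto simp: spaced_def)
  have T: "?S s \<in> M \<rightarrow> slice d w 1 \<times> {1..t}" if "s \<le> d - 1" for s
  proof
    fix e assume e: "e \<in> M"
    have "fst (?S s e) l \<in> {1..w}" if "l \<in> {1..<d}" for l
      using le[OF e that, of s] w by auto
    moreover have "fst (?S s e) d = 1" "fst (?S s e) \<in> extensional {1..d}"
      using Xd[OF e] that d by (auto simp: spaced_def extensional_def)
    ultimately have "fst (?S s e) \<in> slice d w 1"
      using slice_iff[of d "fst (?S s e)" w 1] d by simp
    then show "?S s e \<in> slice d w 1 \<times> {1..t}"
      using \<kappa>[OF e, of s] by (simp add: mem_Times_iff) (simp add: spaced_def)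
  qed
  have inj': "inj_on (?S s) M" if "s \<le> d - 1" for s
  proof (rule inj_onI)
    fix a b assume ab: "a \<in> M" "b \<in> M" "?S s a = ?S s b"
    have "fst (mixed c \<kappa> X s a) l = fst (mixed c \<kappa> X s b) l" for l
    proof -
      have "fst (?S s a) l = fst (?S s b) l" using ab(3) by simp
      then show ?thesis using Xs[OF ab(1), of l] Xs[OF ab(2), of l]
        by (cases "l \<in> {1..s}"; cases "l \<in> {1..<d}") (auto simp: spaced_def mixed_def)
    qed
    moreover have "\<kappa> s a = \<kappa> s b" using ab(3) by (simp add: spaced_def)
    ultimately have "mixed c \<kappa> X s a = mixed c \<kappa> X s b"
      by (intro prod_eqI ext) (simp_all add: mixed_def)
    then show "a = b" using inj[OF that] ab by (auto dest: inj_onD)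
  qed
  show ?thesis
  proof (rule route_chain)
    fix s assume s: "s < d - 1"
    have "Suc s * ?L \<le> (d - 1) * ?L" using s by (intro mult_right_mono) auto
    then have hi: "lo + s * ?L + ?L - 1 \<le> w" using lo by simp
    \<comment> \<open>For the first move coordinate 2 is still odd in all points, and later
      coordinate 1 is already even in all of them. So the detour coordinate always has a common
      parity, recorded by \<open>\<beta>\<close>.\<close>
    define j' where "j' = (if s = 0 then 2 else 1 :: nat)"
    have j': "j' \<in> {1..<d}" "Suc s \<noteq> j'" using d by (auto simp: j'_def)
    have j: "Suc s \<in> {1..<d}" using s by auto
    show "route d w t (lo + s * ?L) (lo + s * ?L + ?L - 1) M (?S s) (?S (Suc s))"
    proof (rule route_permute[where j = "Suc s" and j' = j' and \<beta> = "s \<noteq> 0"])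
      fix e assume e: "e \<in> M"
      show "fst (?S (Suc s) e) = (fst (?S s e))(Suc s := fst (?S (Suc s) e) (Suc s))"
        by (auto simp: spaced_def)
      show "odd (fst (?S s e) (Suc s))" using Xs[OF e j] j by (simp add: spaced_def)
      show "even (fst (?S (Suc s) e) (Suc s))" by (simp add: spaced_def)
      show "even (fst (?S s e) j') = (s \<noteq> 0)" using Xs[OF e j'(1)] j' by (simp add: spaced_def j'_def)
      show "fst (?S s e) j' < w" using le[OF e j'(1), of s] w by auto
      \<comment> \<open>The turning height lies at most \<open>4 * n\<close> above the bottom of the
        slab, whose top is \<open>5 * n - 1\<close> above it.\<close>
      show "lo + s * ?L + fst (?S s e) (Suc s) \<le> lo + s * ?L + ?L - 1"
        using le[OF e j, of s] n by auto
    qed (use T inj' s lo hi j j' in auto)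
  qed (use d n in auto)
qed

text \<open>Spreading all coordinates leads to the state \<open>spaced\<close> with no coordinate
  moved, so the two stacks of slabs fit together. The target is written without the points of
  \<open>X\<close>, so that the halves starting from both ends of a pair arrive at the same
  function.\<close>

lemma route_half:
  assumes X: "X \<in> M \<rightarrow> slice d n 1 \<times> {1..t}" "inj_on X M" and d: "d \<ge> 3" and n: "n > 0"
    and c: "\<And>e l. e \<in> M \<Longrightarrow> l \<in> {1..<d} \<Longrightarrow> c e l \<in> {1..2 * n}"
    and \<kappa>: "\<And>j e. e \<in> M \<Longrightarrow> \<kappa> j e \<in> {1..t}" "\<And>e. e \<in> M \<Longrightarrow> \<kappa> 0 e = snd (X e)"
    and inj: "\<And>j. j \<le> d - 1 \<Longrightarrow> inj_on (mixed c \<kappa> X j) M"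
    and lo: "1 \<le> lo" "lo + (d - 1) * (10 * n) - 1 \<le> w"
  shows "route d w t lo (lo + (d - 1) * (10 * n) - 1) M X
    (\<lambda>e. (\<lambda>l. if l \<in> {1..<d} then 2 * c e l else if l = d then 1 else undefined, \<kappa> (d - 1) e))"
proof -
  let ?h = "(d - 1) * (5 * n)"
  have h: "?h > 0" "(d - 1) * (10 * n) = ?h + ?h" using d n by auto
  have "{1..d - 1} = {1..<d}" using d by auto
  then have s0: "spread X (d - 1) e = spaced d c \<kappa> X 0 e" if "e \<in> M" for e
    using \<kappa>(2)[OF that] by (simp add: spread_def spaced_def)
  have "route d w t lo (lo + ?h - 1) M X (spread X (d - 1))"
    using X d n lo h by (intro route_spread) linarith+
  then have r1: "route d w t lo (lo + ?h - 1) M X (spaced d c \<kappa> X 0)"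
    by (rule route_cong[OF _ refl s0])
  have "route d w t (lo + ?h) (lo + ?h + ?h - 1) M (spaced d c \<kappa> X 0) (spaced d c \<kappa> X (d - 1))"
    by (rule route_spaced[OF X(1) d n c \<kappa>(1) inj]) (use lo h in linarith)+
  moreover have "lo + ?h = Suc (lo + ?h - 1)" using h by simp
  ultimately have r2: "route d w t (Suc (lo + ?h - 1)) (lo + ?h + ?h - 1) M
      (spaced d c \<kappa> X 0) (spaced d c \<kappa> X (d - 1))" by simp
  have "route d w t lo (lo + ?h + ?h - 1) M X (spaced d c \<kappa> X (d - 1))"
    by (rule route_trans[OF r1 r2]) (use h lo d in linarith)+
  then show ?thesis unfolding h(2) add.assoc
  proof (rule route_cong)
    fix e assume e: "e \<in> M"
    then have "fst (X e) d = 1" "fst (X e) \<in> extensional {1..d}"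
      using X(1) d slice_iff[of d "fst (X e)" n 1] by (auto simp: Pi_iff mem_Times_iff)
    then show "spaced d c \<kappa> X (d - 1) e =
        (\<lambda>l. if l \<in> {1..<d} then 2 * c e l else if l = d then 1 else undefined, \<kappa> (d - 1) e)"
      by (auto simp: spaced_def extensional_def fun_eq_iff)
  qed simp
qed

section \<open>Joining the two halves at the intermediate points\<close>

theorem theorem15:
  fixes d :: nat
  assumes "d \<ge> 3"
  shows "\<exists>c::nat. c > 0 \<and>
    (\<forall>n t :: nat. n > 0 \<longrightarrow> t > 0 \<longrightarrow>
      (\<forall>M. matching_between (slice d n 1 \<times> {1..t}) (slice d n (c * n) \<times> {1..t}) M \<longrightarrow>
           embeddable (BEC d (c * n) t) M))"
proof (intro exI[of _ "20 * (d - 1)"] conjI allI impI)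
  show "20 * (d - 1) > 0" using assms by simp
  fix n t :: nat and M
  \<comment> \<open>Each half uses \<open>d - 1\<close> slabs for spreading and \<open>d - 1\<close>
    for moving, all of height \<open>5 * n\<close>. The two halves together need
    \<open>20 * (d - 1) * n\<close>.\<close>
  define w where "w = 20 * (d - 1) * n"
  assume n: "n > 0" and "t > 0"
    and "matching_between (slice d n 1 \<times> {1..t}) (slice d n (20 * (d - 1) * n) \<times> {1..t}) M"
  then have M: "M \<subseteq> (slice d n 1 \<times> {1..t}) \<times> (slice d n w \<times> {1..t})"
    and dis: "disjoint_family_on (\<lambda>(p, q). {p, q}) M"
    by (auto simp: matching_between_def w_def)
  let ?h = "(d - 1) * (10 * n)"
  have h: "?h > 0" "w = ?h + ?h" using assms n by (auto simp: w_def)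
  have d: "d \<ge> 1" using assms by simp
  \<comment> \<open>The second endpoint is lowered to height 1 so that both ends can be treated as
    starting points of a climb.\<close>
  define Y where "Y e = at_height d 1 (snd e)" for e :: "(point \<times> nat) \<times> (point \<times> nat)"
  have fin: "finite M"
    using M by (rule finite_subset) (auto simp: slice_def intro!: finite_PiE finite_cartesian_product)
  have X: "fst \<in> M \<rightarrow> slice d n 1 \<times> {1..t}" using M by auto
  have Y: "Y \<in> M \<rightarrow> slice d n 1 \<times> {1..t}"
  proof
    fix e assume "e \<in> M"
    then have "snd e \<in> slice d n w \<times> {1..t}" using M by auto
    then show "Y e \<in> slice d n 1 \<times> {1..t}"
      unfolding Y_def at_height_def mem_Times_iff slice_iff[OF d] using d by (auto simp: extensional_def)
  qed
  have Yw: "at_height d w (Y e) = snd e" if "e \<in> M" for e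
    using M that slice_iff[OF d, of "fst (snd e)" n w]
    by (intro prod_eqI) (auto simp: Y_def at_height_def fun_eq_iff)
  have X1: "at_height d 1 (fst e) = fst e" if "e \<in> M" for e
    using M that slice_iff[OF d, of "fst (fst e)" n 1]
    by (intro prod_eqI) (auto simp: at_height_def fun_eq_iff)
  have inj: "inj_on fst M" "inj_on snd M"
    using dis by (fastforce simp: inj_on_def disjoint_family_on_def)+
  have injY: "inj_on Y M"
    using inj(2) Yw by (metis (no_types, lifting) inj_onI inj_onD)
  have "d - 1 < d" and ivl: "{1..d - 1} = {1..<d}" using d by auto
  from exists_intermediate[OF fin X Y inj(1) injY n this(1)]
  obtain c where c: "\<And>e l. e \<in> M \<Longrightarrow> l \<in> {1..<d} \<Longrightarrow> c e l \<in> {1..2 * n}"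
    and cX: "\<And>j. j \<le> d - 1 \<Longrightarrow> inj_on (mixed c (\<lambda>_ e. snd (fst e)) fst j) M"
    and cY: "\<And>j. j \<le> d - 1 \<Longrightarrow> inj_on (mixed c (\<lambda>_ e. snd (Y e)) Y j) M"
    unfolding ivl by blast
  \<comment> \<open>On the second half the copy stays that of \<open>q\<close> until the last move,
    which switches it to that of \<open>p\<close>. Both halves then end in the same vertex up to
    height.\<close>
  define \<kappa> where "\<kappa> j e = (if j < d - 1 then snd (Y e) else snd (fst e))"
    for j and e :: "(point \<times> nat) \<times> (point \<times> nat)"
  let ?Z = "\<lambda>e. (\<lambda>l. if l \<in> {1..<d} then 2 * c e l else if l = d then 1 else undefined, snd (fst e))"
  have sX: "snd (fst e) \<in> {1..t}" if "e \<in> M" for e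
    using M that by auto
  have "route d w t 1 (1 + ?h - 1) M fst ?Z"
    by (rule route_half[OF X inj(1) assms n c sX refl cX]) (use h in linarith)+
  then have r1: "route d w t 1 ?h M fst ?Z" by simp
  have "route d w t (1 + ?h) (1 + ?h + ?h - 1) M Y ?Z"
  proof -
    have inj\<kappa>: "inj_on (mixed c \<kappa> Y j) M" if "j \<le> d - 1" for j
    proof (cases "j < d - 1")
      case True
      then have "mixed c \<kappa> Y j = mixed c (\<lambda>_ e. snd (Y e)) Y j" by (simp add: mixed_def \<kappa>_def fun_eq_iff)
      then show ?thesis using cY[OF that] by simp
    next
      \<comment> \<open>After the last move nothing of \<open>Y\<close> is left except constants
        shared with the first half, so injectivity is inherited from \<open>cX\<close>.\<close>
      case False
      then have j: "j = d - 1" using that by simp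
      have "mixed c \<kappa> Y j e = mixed c (\<lambda>_ e. snd (fst e)) fst j e" if e: "e \<in> M" for e
      proof (rule prod_eqI)
        have "fst (fst e) \<in> slice d n 1" "fst (Y e) \<in> slice d n 1" 
          using funcset_mem[OF X e] funcset_mem[OF Y e] by (simp_all add: mem_Times_iff)
        then have "fst (fst e) l = fst (Y e) l" if "l \<notin> {1..<d}" for l
          using that unfolding slice_iff[OF d] extensional_def by (cases "l = d") auto
        then show "fst (mixed c \<kappa> Y j e) = fst (mixed c (\<lambda>_ e. snd (fst e)) fst j e)"
          unfolding mixed_def j ivl by (auto simp: fun_eq_iff)
      qed (simp add: mixed_def \<kappa>_def j)
      then show ?thesis using cX[OF that] inj_on_cong[of M "mixed c \<kappa> Y j"] by blast
    qed
    have \<kappa>t: "\<kappa> j e \<in> {1..t}" if "e \<in> M" for j e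
      using sX[OF that] Y that by (auto simp: \<kappa>_def Pi_iff mem_Times_iff)
    have \<kappa>0: "\<kappa> 0 e = snd (Y e)" for e using assms by (simp add: \<kappa>_def)
    have "route d w t (1 + ?h) (1 + ?h + ?h - 1) M Y
        (\<lambda>e. (\<lambda>l. if l \<in> {1..<d} then 2 * c e l else if l = d then 1 else undefined, \<kappa> (d - 1) e))"
      by (rule route_half[OF Y injY assms n c \<kappa>t \<kappa>0 inj\<kappa>]) (use h in linarith)+
    then show ?thesis by (simp add: \<kappa>_def)
  qed
  \<comment> \<open>Reflecting the upper half makes it climb from the intermediate point to
    \<open>q\<close>, so that it continues the lower half.\<close>
  then have "route d w t (1 + ?h) (1 + ?h + ?h - 1) M ?Z Y"
    by (rule route_rev) (use d h in linarith)+
  then have r2: "route d w t (Suc ?h) w M ?Z Y" using h by simp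
  have "route d w t 1 w M fst Y"
    by (rule route_trans[OF r1 r2]) (use h d in linarith)+
  then obtain W where W: "disjoint_family_on W M"
    "\<And>e. e \<in> M \<Longrightarrow> linked (BEC d w t) (W e) (at_height d 1 (fst e)) (at_height d w (Y e))"
    unfolding route_def by blast
  have "\<exists>p. vpath p (with_proj (BEC d w t)) \<and> hd p = fst e \<and> last p = snd e \<and> set p \<subseteq> W e" if "e \<in> M" for e
    using linked_vpath[OF pair_graph_BEC W(2)[OF that]] X1[OF that] Yw[OF that] by simp
  then obtain path where path: "\<And>e. e \<in> M \<Longrightarrow> vpath (path e) (with_proj (BEC d w t)) \<and>
      hd (path e) = fst e \<and> last (path e) = snd e \<and> set (path e) \<subseteq> W e" by metis
  have "disjoint_family_on (\<lambda>e. set (path e)) M"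
    using W(1) path unfolding disjoint_family_on_def by (meson disjoint_iff subsetD)
  then show "embeddable (BEC d (20 * (d - 1) * n) t) M"
    unfolding embeddable_def w_def[symmetric] using path by (intro exI[of _ path]) fastforce
qed

end
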